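(* Let $b,c\in\mathbb{Z}$ and $F(n) = n^2 + b n + c$. Let $T = \begin{pmatrix}1&1\\0&1\end{pmatrix}$ and $U=\begin{pmatrix}1&0\\1&1\end{pmatrix}$. For every $m\ge 1$ and all integers $x_1,\dots,x_m$, $$f_m(x_1,x_2,\dots,x_m) = \phi_m\left[ W^{x_m}\cdots T^{x_{2i}}U^{x_{2i-1}}\cdots T^{x_2}U^{x_1}\right],$$ where the factor with exponent $x_k$ is a power of $U$ for odd $k$ and of $T$ for even $k$; in particular $W = U$ if $m$ is odd and $W = T$ if $m$ is even.
   Context: For $A=\begin{pmatrix}\alpha&\beta\\ \gamma&\delta\end{pmatrix}\in M_2(\mathbb{Z})$ put $\phi_0[A] = \alpha^2 + b\,\alpha\beta + c\,\beta^2$, $\phi_1[A] = \gamma^2 + b\,\gamma\delta + c\,\delta^2$, and for a natural number $m$ let $\phi_m[A]=\phi_0[A]$ if $m$ is even and $\phi_m[A]=\phi_1[A]$ if $m$ is odd. The polynomials $f_m = f_m(x_1,\dots,x_m)\in\mathbb{Z}[x_1,\dots,x_m]$ associated with $F$ are defined by $f_0=1$, $f_1(x_1)=F(x_1)$ and, for $m\ge2$, $$f_m = f_{m-2} + x_m \sum_{j=1}^{2} \left(\tfrac{1}{j!}F^{(j)}\right)\!\left(\sum_{k=1}^{m-1} x_k f_{k-1}\right)(x_m f_{m-1})^{j-1},$$ where $F^{(j)}$ is the $j$th derivative of $F$. They satisfy $F\left(\sum_{k=1}^m x_k f_{k-1}\right) = f_{m-1}f_m$ for all $m\ge 1$. 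*)

theory Defs
  imports "HOL-Analysis.Analysis" "HOL-Computational_Algebra.Polynomial" "HOL-Library.Poly_Mapping"
begin

text \<open>
  Polynomials over \<open>\<int>\<close> in the indeterminates \<open>x\<^sub>1, x\<^sub>2, \<dots>\<close>: finitely supported maps from
  exponent vectors to coefficients, with the convolution product of \<^theory>\<open>HOL-Library.Poly_Mapping\<close>.
\<close>

type_synonym int_mpoly = "(nat \<Rightarrow>\<^sub>0 nat) \<Rightarrow>\<^sub>0 int"

definition indet :: "nat \<Rightarrow> int_mpoly" where
  "indet i = Poly_Mapping.single (Poly_Mapping.single i 1) 1"

definition eval_mpoly :: "int_mpoly \<Rightarrow> (nat \<Rightarrow> int) \<Rightarrow> int" where
  "eval_mpoly p x =
     (\<Sum>e\<in>Poly_Mapping.keys p. Poly_Mapping.lookup p e *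
        (\<Prod>i\<in>Poly_Mapping.keys e. x i ^ Poly_Mapping.lookup e i))"

definition subst_mpoly :: "int poly \<Rightarrow> int_mpoly \<Rightarrow> int_mpoly" where
  "subst_mpoly G p = poly (map_poly of_int G) p"

text \<open>
  The polynomial \<open>(1/j!) F\<^sup>(\<^sup>j\<^sup>)\<close> with integer coefficients. The division is exact, as the lemma
  below shows.
\<close>

definition divided_deriv :: "nat \<Rightarrow> int poly \<Rightarrow> int poly" where
  "divided_deriv j F = map_poly (\<lambda>a. a div fact j) ((pderiv ^^ j) F)"

lemma smult_fact_divided_deriv: "smult (fact j) (divided_deriv j F) = (pderiv ^^ j) F"
proof (rule poly_eqI)
  fix n
  have "pochhammer (int (Suc n)) j = fact j * int ((n + j) choose j)"
  proof -
    have "pochhammer (real (Suc n)) j = fact j * real ((n + j) choose j)"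
      by (simp add: binomial_gbinomial gbinomial_pochhammer' algebra_simps)
    then have "of_int (pochhammer (int (Suc n)) j) = (of_int (fact j * int ((n + j) choose j)) :: real)"
      by (simp add: pochhammer_of_int [symmetric] pochhammer_of_nat [symmetric])
    then show ?thesis by (simp only: of_int_eq_iff)
  qed
  then have "fact j dvd coeff ((pderiv ^^ j) F) n"
    by (simp add: coeff_higher_pderiv)
  then show "coeff (smult (fact j) (divided_deriv j F)) n = coeff ((pderiv ^^ j) F) n"
    by (simp add: divided_deriv_def coeff_map_poly)
qed

text \<open>The polynomials \<open>f\<^sub>m\<close> associated with a quadratic polynomial \<open>F\<close>.\<close>

fun assoc_mpoly :: "int poly \<Rightarrow> nat \<Rightarrow> int_mpoly" where
  "assoc_mpoly F m =
     (if m = 0 then 1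
      else if m = 1 then subst_mpoly F (indet 1)
      else assoc_mpoly F (m - 2) +
        indet m * (\<Sum>j=1..2. subst_mpoly (divided_deriv j F)
                                (\<Sum>k=1..m-1. indet k * assoc_mpoly F (k - 1)) *
                              (indet m * assoc_mpoly F (m - 1)) ^ (j - 1)))"

declare assoc_mpoly.simps [simp del]

definition phi0 :: "int \<Rightarrow> int \<Rightarrow> int^2^2 \<Rightarrow> int" where
  "phi0 b c A = (A$1$1)^2 + b * (A$1$1) * (A$1$2) + c * (A$1$2)^2"

definition phi1 :: "int \<Rightarrow> int \<Rightarrow> int^2^2 \<Rightarrow> int" where
  "phi1 b c A = (A$2$1)^2 + b * (A$2$1) * (A$2$2) + c * (A$2$2)^2"

definition phi :: "int \<Rightarrow> int \<Rightarrow> nat \<Rightarrow> int^2^2 \<Rightarrow> int" where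
  "phi b c m A = (if even m then phi0 b c A else phi1 b c A)"

definition T_mat :: "int^2^2" where
  "T_mat = vector [vector [1, 1], vector [0, 1]]"

definition U_mat :: "int^2^2" where
  "U_mat = vector [vector [1, 0], vector [1, 1]]"

text \<open>
  Powers with respect to the matrix product \<open>**\<close>; the operations \<open>*\<close> and \<open>^\<close> on
  \<open>int^2^2\<close> act componentwise. The exponent may be negative only for invertible matrices.
\<close>

definition mat_powi :: "int^2^2 \<Rightarrow> int \<Rightarrow> int^2^2" where
  "mat_powi A k =
     (if k \<ge> 0 then (((**) A) ^^ nat k) (mat 1)
      else (((**) (matrix_inv A)) ^^ nat (- k)) (mat 1))"

text \<open>New factors are multiplied on the left, so that the factor for \<open>x\<^sub>1\<close> is the rightmost.\<close>

primrec TU_prod :: "(nat \<Rightarrow> int) \<Rightarrow> nat \<Rightarrow> int^2^2" where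
  "TU_prod x 0 = mat 1"
| "TU_prod x (Suc k) = mat_powi (if odd (Suc k) then U_mat else T_mat) (x (Suc k)) ** TU_prod x k"

end

theory Submission
  imports Defs
begin

text \<open>
  Let \<open>Q(u, v) = u\<^sup>2 + b u v + c v\<^sup>2\<close> be the homogenization of \<open>F\<close>, so that \<open>\<phi>\<^sub>0\<close> and \<open>\<phi>\<^sub>1\<close> are the
  values of \<open>Q\<close> at the two rows of a matrix. Multiplication on the left by \<open>T\<^sup>k\<close> or \<open>U\<^sup>k\<close>
  keeps one row \<open>s\<close> and replaces the other row \<open>r\<close> by \<open>r + k s\<close>, and
  \[ Q(r + k s) = Q(r) + k B(r, s) + k^2 Q(s), \]
  where \<open>B\<close> is the polar form of \<open>Q\<close>. For the rows of a matrix \<open>A\<close> of determinant 1, the number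
  \<open>B\<close> equals \<open>2 h + b = F'(h)\<close> with the integer \<open>h\<close> given by \<open>half_polar\<close> below. This \<open>h\<close> grows by \<open>k Q(s)\<close>
  under the same row operation and vanishes at the identity matrix, so that after \<open>m\<close> factors
  it is exactly \<open>\<Sum>\<^sub>k\<^sub>\<le>\<^sub>m x\<^sub>k f\<^sub>k\<^sub>-\<^sub>1\<close>, the argument of \<open>F'\<close> in the recurrence of the \<open>f\<^sub>m\<close>. As
  \<open>\<onehalf> F''\<close> is the constant 1, the displayed expansion then becomes this recurrence: \<open>s\<close> is the
  row changed in the step before and carries \<open>f\<^sub>m\<^sub>-\<^sub>1\<close>, and \<open>r\<close> carries \<open>f\<^sub>m\<^sub>-\<^sub>2\<close>.

  What remains is that evaluation of polynomials at integers respects the recurrence, which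
  holds because it is a ring homomorphism.
\<close>

section \<open>Evaluation as a ring homomorphism\<close>

definition monomial_value :: "(nat \<Rightarrow>\<^sub>0 nat) \<Rightarrow> (nat \<Rightarrow> int) \<Rightarrow> int" where
  "monomial_value e x = (\<Prod>i\<in>Poly_Mapping.keys e. x i ^ Poly_Mapping.lookup e i)"

lemma monomial_value_superset:
  assumes "finite S" "Poly_Mapping.keys e \<subseteq> S"
  shows "monomial_value e x = (\<Prod>i\<in>S. x i ^ Poly_Mapping.lookup e i)"
  unfolding monomial_value_def using assms
  by (intro prod.mono_neutral_left) (auto simp: in_keys_iff)

lemma monomial_value_zero [simp]: "monomial_value 0 x = 1"
  by (simp add: monomial_value_def)

lemma monomial_value_add:
  "monomial_value (d + e) x = monomial_value d x * monomial_value e x"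
proof -
  let ?S = "Poly_Mapping.keys d \<union> Poly_Mapping.keys e"
  have "Poly_Mapping.keys (d + e) \<subseteq> ?S"
    by (rule keys_add)
  then show ?thesis
    by (simp add: monomial_value_superset [where S = ?S] lookup_add power_add prod.distrib)
qed

text \<open>
  Terms of \<open>p\<close> and \<open>q\<close> may cancel in \<open>p + q\<close>. Summing over a common superset of the supports
  makes evaluation visibly linear.
\<close>

lemma eval_mpoly_superset:
  assumes "finite S" "Poly_Mapping.keys p \<subseteq> S"
  shows "eval_mpoly p x = (\<Sum>e\<in>S. Poly_Mapping.lookup p e * monomial_value e x)"
  unfolding eval_mpoly_def monomial_value_def [symmetric] using assms
  by (intro sum.mono_neutral_left) (auto simp: in_keys_iff)

lemma eval_mpoly_single [simp]:
  "eval_mpoly (Poly_Mapping.single e a) x = a * monomial_value e x"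
  by (simp add: eval_mpoly_superset [where S = "{e}"])

lemma eval_mpoly_zero [simp]: "eval_mpoly 0 x = 0"
  by (simp add: eval_mpoly_def)

lemma eval_mpoly_one [simp]: "eval_mpoly 1 x = 1"
  by (simp flip: single_one)

lemma eval_mpoly_of_int [simp]: "eval_mpoly (of_int k) x = k"
  using eval_mpoly_single [of 0 "of_int k" x] by (simp only: single_of_int) simp

lemma eval_mpoly_indet [simp]: "eval_mpoly (indet i) x = x i"
  by (simp add: indet_def monomial_value_def)

lemma eval_mpoly_add [simp]: "eval_mpoly (p + q) x = eval_mpoly p x + eval_mpoly q x"
proof -
  let ?S = "Poly_Mapping.keys p \<union> Poly_Mapping.keys q"
  have "Poly_Mapping.keys (p + q) \<subseteq> ?S"
    by (rule keys_add)
  then show ?thesis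
    by (simp add: eval_mpoly_superset [where S = ?S] lookup_add distrib_right sum.distrib)
qed

lemma eval_mpoly_sum [simp]: "eval_mpoly (sum g I) x = (\<Sum>i\<in>I. eval_mpoly (g i) x)"
  by (induction I rule: infinite_finite_induct) auto

lemma poly_mapping_sum_singles:
  "p = (\<Sum>e\<in>Poly_Mapping.keys p. Poly_Mapping.single e (Poly_Mapping.lookup p e))"
  by (rule poly_mapping_eqI)
    (simp add: lookup_sum lookup_single when_def sum.delta' in_keys_iff)

lemma eval_mpoly_mult [simp]: "eval_mpoly (p * q) x = eval_mpoly p x * eval_mpoly q x"
proof -
  let ?P = "Poly_Mapping.keys p" and ?Q = "Poly_Mapping.keys q"
  let ?s = "\<lambda>p e. Poly_Mapping.single e (Poly_Mapping.lookup p e)"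
  have "p * q = (\<Sum>d\<in>?P. ?s p d) * (\<Sum>e\<in>?Q. ?s q e)"
    by (simp flip: poly_mapping_sum_singles)
  also have "\<dots> = (\<Sum>d\<in>?P. \<Sum>e\<in>?Q. Poly_Mapping.single (d + e)
                     (Poly_Mapping.lookup p d * Poly_Mapping.lookup q e))"
    by (simp add: sum_product mult_single)
  finally have "eval_mpoly (p * q) x =
      (\<Sum>d\<in>?P. Poly_Mapping.lookup p d * monomial_value d x) *
      (\<Sum>e\<in>?Q. Poly_Mapping.lookup q e * monomial_value e x)"
    by (simp add: monomial_value_add sum_product mult_ac)
  then show ?thesis
    by (simp only: eval_mpoly_superset [OF finite_keys order_refl])
qed

lemma eval_subst_mpoly: "eval_mpoly (subst_mpoly G p) x = poly G (eval_mpoly p x)"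
  unfolding subst_mpoly_def by (induction G) (simp_all add: map_poly_pCons)

section \<open>The recurrence for a monic quadratic polynomial\<close>

lemma divided_deriv_1_quadratic: "divided_deriv 1 [:c, b, 1:] = [:b, 2:]"
  by (simp add: divided_deriv_def pderiv_pCons map_poly_pCons)

lemma divided_deriv_2_quadratic: "divided_deriv 2 [:c, b, 1:] = [:1:]"
  by (simp add: divided_deriv_def pderiv_pCons map_poly_pCons numeral_2_eq_2)

lemma eval_assoc_mpoly_0: "eval_mpoly (assoc_mpoly F 0) x = 1"
  by (simp add: assoc_mpoly.simps)

lemma eval_assoc_mpoly_1: "eval_mpoly (assoc_mpoly F (Suc 0)) x = poly F (x 1)"
  by (simp add: assoc_mpoly.simps eval_subst_mpoly)

lemma eval_assoc_mpoly_quadratic_rec: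
  fixes b c :: int and x :: "nat \<Rightarrow> int"
  defines "f \<equiv> \<lambda>m. eval_mpoly (assoc_mpoly [:c, b, 1:] m) x"
  assumes "m > 0"
  shows "f (Suc m) = f (m - 1) +
           x (Suc m) * (2 * (\<Sum>k=1..m. x k * f (k - 1)) + b + x (Suc m) * f m)"
proof -
  have "{1..2::nat} = {1, 2}"
    by auto
  then show ?thesis
    using \<open>m > 0\<close> unfolding f_def
    by (subst assoc_mpoly.simps)
      (simp add: eval_subst_mpoly divided_deriv_1_quadratic [unfolded One_nat_def]
        divided_deriv_2_quadratic algebra_simps)
qed

section \<open>Powers of the elementary matrices\<close>

lemma mat2_eq_iff:
  "A = B \<longleftrightarrow> A$1$1 = B$1$1 \<and> A$1$2 = B$1$2 \<and> A$2$1 = B$2$1 \<and> A$2$2 = B$2$2"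
  for A B :: "'a^2^2"
  by (auto simp: vec_eq_iff forall_2)

lemma matrix_mult_2_nth: "(A ** B)$i$j = A$i$1 * B$1$j + A$i$2 * B$2$j"
  for A B :: "'a::semiring_1^2^2"
  by (simp add: matrix_matrix_mult_def sum_2)

lemma mat_1_2_nth: "mat 1 = (vector [vector [1, 0], vector [0, 1]] :: 'a::semiring_1^2^2)"
  by (simp add: mat2_eq_iff mat_def)

lemma matrix_inv_eqI:
  fixes A B :: "'a::semiring_1^'n^'n"
  assumes "A ** B = mat 1" "B ** A = mat 1"
  shows "matrix_inv A = B"
proof -
  have "A ** matrix_inv A = mat 1 \<and> matrix_inv A ** A = mat 1"
    unfolding matrix_inv_def by (rule someI [of _ B]) (simp add: assms)
  then show ?thesis
    by (metis assms(2) matrix_mul_assoc matrix_mul_lid matrix_mul_rid)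
qed

text \<open>
  This identifies integer powers without a case distinction on the sign of the exponent: it is
  enough to know a homomorphism from the integers with the right value at 1.
\<close>

lemma mat_powi_one_parameter:
  fixes g :: "int \<Rightarrow> int^2^2"
  assumes g0: "g 0 = mat 1" and g_add: "\<And>j k. g (j + k) = g j ** g k"
  shows "mat_powi (g 1) k = g k"
proof -
  have power: "((**) (g j) ^^ n) (mat 1) = g (int n * j)" for j n
    by (induction n) (simp_all add: g0 distrib_right flip: g_add)
  have "matrix_inv (g 1) = g (- 1)"
    by (rule matrix_inv_eqI) (simp_all add: g0 flip: g_add)
  then show ?thesis
    by (simp add: mat_powi_def power)
qed

lemma mat_powi_T: "mat_powi T_mat k = vector [vector [1, k], vector [0, 1]]"
  using mat_powi_one_parameter [of "\<lambda>k. vector [vector [1, k], vector [0, 1]]" k]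
  by (simp add: T_mat_def mat2_eq_iff matrix_mult_2_nth mat_1_2_nth)

lemma mat_powi_U: "mat_powi U_mat k = vector [vector [1, 0], vector [k, 1]]"
  using mat_powi_one_parameter [of "\<lambda>k. vector [vector [1, 0], vector [k, 1]]" k]
  by (simp add: U_mat_def mat2_eq_iff matrix_mult_2_nth mat_1_2_nth)

section \<open>The quadratic form along the matrix product\<close>

text \<open>
  With rows \<open>(\<alpha>, \<beta>)\<close> and \<open>(\<gamma>, \<delta>)\<close>, the polar form of \<open>Q\<close> is
  \<open>2\<alpha>\<gamma> + b (\<alpha>\<delta> + \<beta>\<gamma>) + 2c\<beta>\<delta>\<close>. It need not be even; removing \<open>b\<close> times the determinant
  leaves \<open>2\<alpha>\<gamma> + 2b\<beta>\<gamma> + 2c\<beta>\<delta>\<close>, twice the following integer.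
\<close>

definition half_polar :: "int \<Rightarrow> int \<Rightarrow> int^2^2 \<Rightarrow> int" where
  "half_polar b c A = A$1$1 * A$2$1 + b * A$1$2 * A$2$1 + c * A$1$2 * A$2$2"

lemma det_TU_prod: "det (TU_prod x m) = 1"
  by (induction m) (simp_all add: det_mul mat_powi_T mat_powi_U det_2 [of "vector _"])

lemma phi_TU_prod_Suc_same: "phi b c m (TU_prod x (Suc m)) = phi b c m (TU_prod x m)"
  by (simp add: phi_def phi0_def phi1_def mat_powi_T mat_powi_U matrix_mult_2_nth)

lemma half_polar_TU_prod_Suc:
  "half_polar b c (TU_prod x (Suc m)) =
     half_polar b c (TU_prod x m) + x (Suc m) * phi b c m (TU_prod x m)"
  by (simp add: half_polar_def phi_def phi0_def phi1_def mat_powi_T mat_powi_U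
      matrix_mult_2_nth algebra_simps power2_eq_square)

text \<open>
  This is the expansion of \<open>Q(r + k s)\<close>; the polar form enters as \<open>2 h + b = F'(h)\<close>, which is the
  shape in which the recurrence of the \<open>f\<^sub>m\<close> contains it.
\<close>

lemma phi_TU_prod_Suc:
  "phi b c (Suc m) (TU_prod x (Suc m)) =
     phi b c (Suc m) (TU_prod x m) +
     x (Suc m) * (2 * half_polar b c (TU_prod x m) + b + x (Suc m) * phi b c m (TU_prod x m))"
proof -
  let ?A = "TU_prod x m"
  \<comment> \<open>Multiplying \<open>b\<close> by the determinant turns \<open>2 h + b\<close> into the polar form, which is bilinear in
    the rows.\<close>
  have "b = b * (?A$1$1 * ?A$2$2 - ?A$1$2 * ?A$2$1)"
    using det_TU_prod [of x m] by (simp add: det_2)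
  then have b: "2 * half_polar b c ?A + b =
      2 * ?A$1$1 * ?A$2$1 + b * (?A$1$1 * ?A$2$2 + ?A$1$2 * ?A$2$1) + 2 * c * ?A$1$2 * ?A$2$2"
    by (simp add: half_polar_def algebra_simps)
  show ?thesis
    unfolding b
    by (simp add: phi_def phi0_def phi1_def mat_powi_T mat_powi_U
        matrix_mult_2_nth algebra_simps power2_eq_square)
qed

text \<open>
  The induction has to follow both rows and \<open>half_polar\<close> together. At the identity matrix the
  second row has the value \<open>c\<close>, which takes the place of \<open>f\<^sub>-\<^sub>1\<close>: with it the step to
  \<open>f\<^sub>1 = F(x\<^sub>1) = c + x\<^sub>1 (b + x\<^sub>1)\<close> has the same form as all later steps.
\<close>

lemma TU_prod_invariant:
  fixes b c :: int and x :: "nat \<Rightarrow> int"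
  defines "f \<equiv> \<lambda>m. eval_mpoly (assoc_mpoly [:c, b, 1:] m) x"
  shows "phi b c m (TU_prod x m) = f m \<and>
         phi b c (Suc m) (TU_prod x m) = (if m = 0 then c else f (m - 1)) \<and>
         half_polar b c (TU_prod x m) = (\<Sum>k=1..m. x k * f (k - 1))"
proof (induction m)
  case 0
  show ?case
    by (simp add: f_def eval_assoc_mpoly_0 phi_def phi0_def phi1_def half_polar_def mat_1_2_nth)
next
  case (Suc m)
  have "phi b c (Suc m) (TU_prod x (Suc m)) = f (Suc m)"
  proof (cases "m = 0")
    case True
    then show ?thesis
      using Suc by (simp add: phi_TU_prod_Suc f_def eval_assoc_mpoly_0 eval_assoc_mpoly_1
          algebra_simps del: TU_prod.simps)
  next
    case False
    then show ?thesis
      using Suc eval_assoc_mpoly_quadratic_rec [of m c b x]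
      by (simp add: phi_TU_prod_Suc f_def del: TU_prod.simps)
  qed
  moreover have "phi b c (Suc (Suc m)) (TU_prod x (Suc m)) = f m"
    using Suc phi_TU_prod_Suc_same [of b c m x] by (simp add: phi_def)
  moreover have "half_polar b c (TU_prod x (Suc m)) = (\<Sum>k=1..Suc m. x k * f (k - 1))"
    using Suc by (simp add: half_polar_TU_prod_Suc del: TU_prod.simps)
  ultimately show ?case
    by simp
qed

theorem corollary4p10:
  fixes b c :: int and m :: nat and x :: "nat \<Rightarrow> int"
  assumes "m \<ge> 1"
  shows "eval_mpoly (assoc_mpoly [:c, b, 1:] m) x = phi b c m (TU_prod x m)"
  using TU_prod_invariant [of b c m x] by simp

end
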